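(* Let $n\ge 2$. Let $\omega_\Sigma:\mathbb{R}\to[0,\infty)$ be continuous, with $\omega_\Sigma(0)=0$, smooth on $\mathbb{R}\setminus\{0\}$, and such that $0$ is its only zero. Let $\Sigma$ be the rotationally symmetric pinching cylinder in $\mathbb{R}^{n+1}$ with profile $\omega_\Sigma$. Assume that there is a constant $C_\Sigma\ge 0$ such that $$\langle \nu_\Sigma(z),e_1\rangle > C_\Sigma\quad\text{for all } z\in\mathbb{R}$$ (at $z=0$ understood as limits from above and below), and that $$z\,\frac{d\omega_\Sigma}{dz}(z)>0\quad\text{for all } z\in\mathbb{R}\setminus\{0\}.$$ Let $\omega_0$ be admissible initial data, and let $\omega:D(t)\times[0,T)\to\mathbb{R}$, $D(t)=(0,r(t))$, be the solution on its maximal time interval of the graphical, rotationally symmetric mean curvature flow with free boundary on $\Sigma$ and initial data $\omega_0$. Let $F:D^n\times[0,T)\to\mathbb{R}^{n+1}$ be the generated family of rotationally symmetric hypersurfaces. (Here $T<\infty$ and the hypersurfaces contract to the point $(0,0)$ as $t\to T$.) Then the singularity of the flow at time $T$ is not Type 0.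
   Context: **Coordinates.** Write points of $\mathbb{R}^{n+1}$ as $(x,z)$ with $x\in\mathbb{R}^n$, $z\in\mathbb{R}$, and put $y=|x|$. The $z$-axis $Oz$ is the axis of rotation. Profile curves lie in the $(y,z)$-half-plane, and $e_1$ is the unit vector in the $y$-direction. $D^n$ is the $n$-dimensional disk. **Pinching cylinder (with one pinching point at $0$).** The support hypersurface $\Sigma$ is generated by rotating the curve $\{(y,z): y=\omega_\Sigma(z)\}$ about $Oz$, where $\omega_\Sigma:Oz\to[0,\infty)$ is continuous, is smooth away from its single zero $z=0$, and satisfies $z\,\omega_\Sigma'(z)>0$ outside some compact set containing $0$. Its unit normal in $(y,z)$-coordinates is $$\nu_\Sigma(z)=\frac{1}{\sqrt{1+(\omega_\Sigma'(z))^2}}\,\bigl(1,-\omega_\Sigma'(z)\bigr).$$ **The flow.** A rotationally symmetric graphical mean curvature flow with free boundary on $\Sigma$ is given by functions $r(t)>0$ and $\omega(\cdot,t):(0,r(t))\to\mathbb{R}$, $t\in[0,T)$, satisfying $$\frac{\partial\omega}{\partial t}=\frac{d^2\omega}{dy^2}\,\frac{1}{1+(\frac{d\omega}{dy})^2}+\frac{n-1}{y}\,\frac{d\omega}{dy}\quad\text{on }(0,r(t))\times[0,T),$$ with boundary conditions at $y=r(t)$ $$\langle\nu_\omega,\nu_\Sigma\rangle=0\quad\text{and}\quad r(t)=\omega_\Sigma(\omega(r(t),t)),$$ where $\nu_\omega=\frac{1}{\sqrt{1+(d\omega/dy)^2}}\bigl(-\frac{d\omega}{dy},1\bigr)$ and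 $\nu_\Sigma$ is evaluated at $z=\omega(r(t),t)$. The orthogonality condition is equivalent to $\frac{d\omega}{dy}(r(t),t)=-\omega_\Sigma'(\omega(r(t),t))$. In addition, $\lim_{y\to0}\frac1y\frac{d\omega}{dy}(y,t)$ exists and $\omega(\cdot,0)=\omega_0$. The hypersurface $F(D^n,t)$ is $\{(x,\omega(|x|,t)):|x|\le r(t)\}$. The family $F$ moves by mean curvature ($\partial_tF=\vec H$, up to tangential reparametrisation), meets $\Sigma$ orthogonally along its boundary, and has its boundary on $\Sigma$. **Admissible initial data.** $\omega_0\in C^2((0,r(0)))$, satisfying the same boundary conditions at $y=r(0)$: $\langle\nu_{\omega_0},\nu_\Sigma\rangle=0$ and $r(0)=\omega_\Sigma(\omega_0(r(0)))$. **Known background fact.** Under the stated hypotheses on $\Sigma$ (the graph condition $\langle\nu_\Sigma,e_1\rangle>C_\Sigma\ge0$ and $z\,\omega_\Sigma'(z)>0$ for $z\ne0$), the maximal existence time $T$ of any such flow is finite and the hypersurfaces contract to the point $(0,0)$ as $t\to T$. "The singularity" means this singularity at time $T$. **Type 0 singularity.** With $A$ the second fundamental form of $F(\cdot,t)$, the singularity at time $T$ is Type 0 if there exist $\varepsilon>0$ and $C<\infty$ with $|A|^2(x,t)\le C$ for all $x\in D^n$ and all $t\in(T-\varepsilon,T)$. *)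

theory Defs
  imports "HOL-Analysis.Analysis"
begin

section \<open>The support hypersurface\<close>

text \<open>Smooth away from 0 is expressed by differentiability of all iterated derivatives on the
  open set of nonzero reals.\<close>

definition pinching_cylinder :: "(real \<Rightarrow> real) \<Rightarrow> bool" where
  "pinching_cylinder \<omega>S \<longleftrightarrow>
     continuous_on UNIV \<omega>S \<and>
     (\<forall>z. \<omega>S z \<ge> 0) \<and>
     (\<forall>z. \<omega>S z = 0 \<longleftrightarrow> z = 0) \<and>
     (\<forall>k. (deriv ^^ k) \<omega>S differentiable_on (- {0})) \<and>
     (\<exists>K. compact K \<and> 0 \<in> K \<and> (\<forall>z. z \<notin> K \<longrightarrow> z * deriv \<omega>S z > 0))"

text \<open>Vectors in the profile half-plane are pairs with the \<open>y\<close>-component first.\<close>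

definition e1 :: "real \<times> real" where
  "e1 = (1, 0)"

definition normal_support :: "(real \<Rightarrow> real) \<Rightarrow> real \<Rightarrow> real \<times> real" where
  "normal_support \<omega>S z = (1 / sqrt (1 + (deriv \<omega>S z)\<^sup>2)) *\<^sub>R (1, - deriv \<omega>S z)"

text \<open>At \<open>z = 0\<close> the profile need not be differentiable; there the inequality is imposed on the two
  one-sided limits, which are required to exist.\<close>

definition graph_condition :: "(real \<Rightarrow> real) \<Rightarrow> real \<Rightarrow> bool" where
  "graph_condition \<omega>S C \<longleftrightarrow>
     (\<forall>z. z \<noteq> 0 \<longrightarrow> normal_support \<omega>S z \<bullet> e1 > C) \<and>
     (\<exists>L > C. ((\<lambda>z. normal_support \<omega>S z \<bullet> e1) \<longlongrightarrow> L) (at_right 0)) \<and>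
     (\<exists>L > C. ((\<lambda>z. normal_support \<omega>S z \<bullet> e1) \<longlongrightarrow> L) (at_left 0))"


section \<open>The free boundary flow of rotationally symmetric graphs\<close>

text \<open>The unit normal of a graph with slope \<open>p\<close>.\<close>

definition normal_graph :: "real \<Rightarrow> real \<times> real" where
  "normal_graph p = (1 / sqrt (1 + p\<^sup>2)) *\<^sub>R (- p, 1)"

text \<open>The slope of \<open>u\<close> at the boundary point \<open>y = \<rho>\<close> is its left derivative there; in particular
  \<open>u \<rho>\<close> is the limit of \<open>u\<close> from inside.\<close>

definition free_boundary_condition :: "(real \<Rightarrow> real) \<Rightarrow> real \<Rightarrow> (real \<Rightarrow> real) \<Rightarrow> bool" where
  "free_boundary_condition \<omega>S \<rho> u \<longleftrightarrow>
     (\<exists>p. (u has_real_derivative p) (at_left \<rho>) \<and>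
          normal_graph p \<bullet> normal_support \<omega>S (u \<rho>) = 0) \<and>
     \<rho> = \<omega>S (u \<rho>)"

lemma orthogonality_iff_slope:
  "normal_graph p \<bullet> normal_support \<omega>S z = 0 \<longleftrightarrow> p = - deriv \<omega>S z"
proof -
  define K where "K = (1 / sqrt (1 + p\<^sup>2)) * (1 / sqrt (1 + (deriv \<omega>S z)\<^sup>2))"
  have "1 + p\<^sup>2 > 0" "1 + (deriv \<omega>S z)\<^sup>2 > 0"
    by (simp_all add: add_pos_nonneg)
  then have "K \<noteq> 0"
    by (simp add: K_def)
  moreover have "normal_graph p \<bullet> normal_support \<omega>S z = K * (- p - deriv \<omega>S z)"
    by (simp add: normal_graph_def normal_support_def K_def diff_divide_distrib)
  ultimately show ?thesis
    by auto
qed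

definition C2_on :: "real set \<Rightarrow> (real \<Rightarrow> real) \<Rightarrow> bool" where
  "C2_on S u \<longleftrightarrow>
     u differentiable_on S \<and> deriv u differentiable_on S \<and> continuous_on S (deriv (deriv u))"

definition admissible_initial_data :: "(real \<Rightarrow> real) \<Rightarrow> real \<Rightarrow> (real \<Rightarrow> real) \<Rightarrow> bool" where
  "admissible_initial_data \<omega>S r0 \<omega>0 \<longleftrightarrow>
     r0 > 0 \<and> C2_on {0<..<r0} \<omega>0 \<and> free_boundary_condition \<omega>S r0 \<omega>0"

text \<open>The profile \<open>\<omega> y t\<close> is a total function of which only the values with \<open>0 \<le> t < T\<close> and
  \<open>0 \<le> y \<le> r t\<close> matter; the values at \<open>y = 0\<close> and \<open>y = r t\<close> are those of the continuous extension.
  The time derivative at \<open>t = 0\<close> is one-sided.\<close>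

definition fb_flow ::
  "nat \<Rightarrow> (real \<Rightarrow> real) \<Rightarrow> real \<Rightarrow> (real \<Rightarrow> real) \<Rightarrow> real \<Rightarrow> (real \<Rightarrow> real) \<Rightarrow> (real \<Rightarrow> real \<Rightarrow> real) \<Rightarrow> bool"
  where
  "fb_flow n \<omega>S r0 \<omega>0 T r \<omega> \<longleftrightarrow>
     T > 0 \<and>
     (\<forall>t\<in>{0..<T}. r t > 0) \<and>
     continuous_on {0..<T} r \<and>
     continuous_on {(y, t). t \<in> {0..<T} \<and> y \<in> {0..r t}} (\<lambda>(y, t). \<omega> y t) \<and>
     (\<forall>t\<in>{0..<T}. C2_on {0<..<r t} (\<lambda>y. \<omega> y t)) \<and>
     (\<forall>t\<in>{0..<T}. \<forall>y\<in>{0<..<r t}.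
        let \<omega>\<^sub>y = deriv (\<lambda>y. \<omega> y t) y; \<omega>\<^sub>y\<^sub>y = deriv (deriv (\<lambda>y. \<omega> y t)) y
        in ((\<lambda>s. \<omega> y s) has_real_derivative
              \<omega>\<^sub>y\<^sub>y * (1 / (1 + \<omega>\<^sub>y\<^sup>2)) + (real n - 1) / y * \<omega>\<^sub>y) (at t within {0..<T})) \<and>
     (\<forall>t\<in>{0..<T}. free_boundary_condition \<omega>S (r t) (\<lambda>y. \<omega> y t)) \<and>
     (\<forall>t\<in>{0..<T}. \<exists>L. ((\<lambda>y. 1 / y * deriv (\<lambda>y. \<omega> y t) y) \<longlongrightarrow> L) (at_right 0)) \<and>
     r 0 = r0 \<and> (\<forall>y\<in>{0<..r0}. \<omega> y 0 = \<omega>0 y)"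

definition maximal_fb_flow ::
  "nat \<Rightarrow> (real \<Rightarrow> real) \<Rightarrow> real \<Rightarrow> (real \<Rightarrow> real) \<Rightarrow> real \<Rightarrow> (real \<Rightarrow> real) \<Rightarrow> (real \<Rightarrow> real \<Rightarrow> real) \<Rightarrow> bool"
  where
  "maximal_fb_flow n \<omega>S r0 \<omega>0 T r \<omega> \<longleftrightarrow>
     fb_flow n \<omega>S r0 \<omega>0 T r \<omega> \<and>
     \<not> (\<exists>T' > T. \<exists>r' \<omega>'. fb_flow n \<omega>S r0 \<omega>0 T' r' \<omega>' \<and>
          (\<forall>t\<in>{0..<T}. r' t = r t \<and> (\<forall>y\<in>{0..r t}. \<omega>' y t = \<omega> y t)))"

text \<open>\<open>\<real>\<^sup>n\<^sup>+\<^sup>1\<close> is the product of \<open>\<real>\<^sup>n\<close> and the axis of rotation, and the parameter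
  domain \<open>D\<^sup>n\<close> is the closed unit disk, scaled to radius \<open>r t\<close> at time \<open>t\<close>.\<close>

definition rotational_family ::
  "(real \<Rightarrow> real) \<Rightarrow> (real \<Rightarrow> real \<Rightarrow> real) \<Rightarrow> real ^ 'n \<Rightarrow> real \<Rightarrow> (real ^ 'n) \<times> real" where
  "rotational_family r \<omega> x t = (r t *\<^sub>R x, \<omega> (norm (r t *\<^sub>R x)) t)"

lemma rotational_family_image:
  assumes "r t > 0"
  shows "(\<lambda>x. rotational_family r \<omega> x t) ` cball (0 :: real ^ 'n) 1 =
         {(x, \<omega> (norm x) t) | x. norm x \<le> r t}"
proof (intro equalityI subsetI)
  fix p :: "(real ^ 'n) \<times> real"
  assume "p \<in> {(x, \<omega> (norm x) t) | x. norm x \<le> r t}"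
  then obtain x where x: "p = (x, \<omega> (norm x) t)" "norm x \<le> r t"
    by blast
  have "p = rotational_family r \<omega> ((1 / r t) *\<^sub>R x) t"
    using assms x by (simp add: rotational_family_def)
  moreover have "(1 / r t) *\<^sub>R x \<in> cball 0 1"
    using assms x by (simp add: field_simps)
  ultimately show "p \<in> (\<lambda>x. rotational_family r \<omega> x t) ` cball 0 1"
    by blast
qed (use assms in \<open>auto simp: rotational_family_def mult_left_le\<close>)

definition contracts_to :: "real \<Rightarrow> (real ^ 'n \<Rightarrow> real \<Rightarrow> (real ^ 'n) \<times> real) \<Rightarrow> (real ^ 'n) \<times> real \<Rightarrow> bool" where
  "contracts_to T F p \<longleftrightarrow>
     (\<forall>e > 0. \<forall>\<^sub>F t in at_left T. (\<lambda>x. F x t) ` cball 0 1 \<subseteq> ball p e)"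


section \<open>Second fundamental form and Type 0 singularities\<close>

text \<open>The following are defined for an arbitrary hypersurface parametrised by \<open>X\<close> over \<open>D\<close>.
  Derivatives are taken within \<open>D\<close>, hence one-sided at boundary points of \<open>D\<close>.\<close>

definition partial_within ::
  "(real ^ 'n) set \<Rightarrow> 'n \<Rightarrow> (real ^ 'n \<Rightarrow> 'b::real_normed_vector) \<Rightarrow> real ^ 'n \<Rightarrow> 'b" where
  "partial_within D i X x = frechet_derivative X (at x within D) (axis i 1)"

definition twice_differentiable_within ::
  "(real ^ 'n) set \<Rightarrow> (real ^ 'n \<Rightarrow> 'b::real_normed_vector) \<Rightarrow> real ^ 'n \<Rightarrow> bool" where
  "twice_differentiable_within D X x \<longleftrightarrow>
     X differentiable (at x within D) \<and>
     (\<forall>\<^sub>F x' in at x within D. X differentiable (at x' within D)) \<and>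
     (\<forall>i. partial_within D i X differentiable (at x within D))"

definition first_fundamental_form ::
  "(real ^ 'n) set \<Rightarrow> (real ^ 'n \<Rightarrow> (real ^ 'n) \<times> real) \<Rightarrow> real ^ 'n \<Rightarrow> real ^ 'n ^ 'n" where
  "first_fundamental_form D X x = (\<chi> i j. partial_within D i X x \<bullet> partial_within D j X x)"

text \<open>The unit normal is determined up to sign, which does not affect the norm of the second
  fundamental form.\<close>

definition unit_normal ::
  "(real ^ 'n) set \<Rightarrow> (real ^ 'n \<Rightarrow> (real ^ 'n) \<times> real) \<Rightarrow> real ^ 'n \<Rightarrow> (real ^ 'n) \<times> real" where
  "unit_normal D X x = (SOME \<nu>. norm \<nu> = 1 \<and> (\<forall>i. \<nu> \<bullet> partial_within D i X x = 0))"

definition second_fundamental_form ::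
  "(real ^ 'n) set \<Rightarrow> (real ^ 'n \<Rightarrow> (real ^ 'n) \<times> real) \<Rightarrow> real ^ 'n \<Rightarrow> real ^ 'n ^ 'n" where
  "second_fundamental_form D X x =
     (\<chi> i j. partial_within D i (partial_within D j X) x \<bullet> unit_normal D X x)"

text \<open>\<open>|A|\<^sup>2 = g\<^sup>i\<^sup>k g\<^sup>j\<^sup>l h\<^sub>i\<^sub>j h\<^sub>k\<^sub>l\<close>, the trace of the square of the
  shape operator \<open>g\<^sup>-\<^sup>1 h\<close>.\<close>

definition norm_A_sq ::
  "(real ^ 'n) set \<Rightarrow> (real ^ 'n \<Rightarrow> (real ^ 'n) \<times> real) \<Rightarrow> real ^ 'n \<Rightarrow> real" where
  "norm_A_sq D X x =
     (let S = matrix_inv (first_fundamental_form D X x) ** second_fundamental_form D X x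
      in trace (S ** S))"

text \<open>The flow is \<open>C\<^sup>2\<close> in the interior only, so the bound is demanded wherever \<open>A\<close> exists.
  For a flow that is \<open>C\<^sup>2\<close> up to the boundary this is all of the closed disk; in general it can
  only fail on the boundary sphere.\<close>

definition type_0_singularity :: "real \<Rightarrow> (real ^ 'n \<Rightarrow> real \<Rightarrow> (real ^ 'n) \<times> real) \<Rightarrow> bool" where
  "type_0_singularity T F \<longleftrightarrow>
     (\<exists>\<epsilon> > 0. \<exists>C. \<forall>t\<in>{T - \<epsilon><..<T}. \<forall>x\<in>cball 0 1.
        twice_differentiable_within (cball 0 1) (\<lambda>x. F x t) x \<longrightarrow>
        norm_A_sq (cball 0 1) (\<lambda>x. F x t) x \<le> C)"

end

theory Submission
  imports Defs
begin

text \<open>Bounded curvature bounds the rotational principal curvature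
  \<open>\<omega>\<^sub>y / (y * sqrt (1 + \<omega>\<^sub>y\<^sup>2))\<close>. At the boundary \<open>y = r t\<close> the slope is
  \<open>- deriv \<omega>S h\<close> and the radius is \<open>\<omega>S h\<close>, where \<open>h\<close> is the boundary
  height, so \<open>\<bar>deriv \<omega>S h\<bar> \<le> K * \<omega>S h\<close> once the hypersurface is small. Since the
  boundary height is continuous in time, never zero and tends to 0, it sweeps out a one-sided
  neighbourhood of 0. On it \<open>\<omega>S\<close> satisfies a linear differential inequality and vanishes at 0,
  so by Gronwall it vanishes identically, contradicting that 0 is its only zero.\<close>

section \<open>Curvature of a rotationally symmetric graph\<close>

text \<open>Chain rule through the norm, whose gradient off the origin is the unit radial vector
  \<open>sgn x\<close>.\<close>

lemma has_derivative_radial: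
  fixes x :: "'a::real_inner"
  assumes "x \<noteq> 0" "(f has_real_derivative d) (at (R * norm x))"
  shows "((\<lambda>x. f (R * norm x)) has_derivative (\<lambda>v. d * (R * (v \<bullet> sgn x)))) (at x)"
proof -
  have "((\<lambda>x. R * norm x) has_derivative (\<lambda>v. R * (v \<bullet> sgn x))) (at x)"
    by (intro has_derivative_mult_right has_derivative_norm assms(1))
  from has_derivative_compose[OF this assms(2)[unfolded has_field_derivative_def]]
  show ?thesis .
qed

text \<open>\<open>frechet_derivative\<close> is a choice; at interior points of \<open>D\<close>
  the derivative is unique, so an explicit one can replace it.\<close>

lemma partial_within_eq:
  assumes "(X has_derivative X') (at x)" "x \<in> interior D"
  shows "partial_within D i X x = X' (axis i 1)"
  unfolding partial_within_def at_within_interior[OF assms(2)]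
    frechet_derivative_at[OF assms(1), symmetric] ..

section \<open>Norms of axis vectors and inverses of diagonal matrices\<close>

lemma norm_axis [simp]: "norm (axis k s :: real ^ 'n) = \<bar>s\<bar>"
  by (simp add: norm_eq_sqrt_inner inner_axis_axis)

lemma matrix_inv_eqI:
  fixes A B :: "'a::semiring_1 ^ 'n ^ 'n"
  assumes "A ** B = mat 1" "B ** A = mat 1"
  shows "matrix_inv A = B"
proof -
  have "A ** matrix_inv A = mat 1 \<and> matrix_inv A ** A = mat 1"
    unfolding matrix_inv_def by (rule someI) (use assms in blast)
  then show ?thesis
    by (metis assms(2) matrix_mul_assoc matrix_mul_lid matrix_mul_rid)
qed

lemma diagonal_matrix_mult:
  fixes a b :: "'n::finite \<Rightarrow> 'a::semiring_1"
  shows "(\<chi> i j. if i = j then a i else 0) ** (\<chi> i j. if i = j then b i else 0) =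
    (\<chi> i j. if i = j then a i * b i else 0)"
proof -
  have "(\<Sum>k\<in>UNIV. (if i = k then a i else 0) * (if k = j then b k else 0)) =
      (\<Sum>k\<in>UNIV. if k = i then if i = j then a i * b i else 0 else 0)" for i j
    by (rule sum.cong) auto
  then show ?thesis
    by (simp add: matrix_matrix_mult_def vec_eq_iff)
qed

text \<open>A time slice of \<open>rotational_family\<close> with \<open>R\<close> for
  \<open>r t\<close>; positivity of \<open>R\<close> turns the norm of the scaled point into
  \<open>R * norm x\<close>.\<close>

definition graph_immersion ::
  "real \<Rightarrow> (real \<Rightarrow> real) \<Rightarrow> real ^ 'n \<Rightarrow> (real ^ 'n) \<times> real" where
  "graph_immersion R u x = (R *\<^sub>R x, u (R * norm x))"

text \<open>The partial derivative of \<open>graph_immersion\<close> off the origin in closed form,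
  ready to be differentiated again.\<close>

definition graph_partial ::
  "real \<Rightarrow> (real \<Rightarrow> real) \<Rightarrow> 'n \<Rightarrow> real ^ 'n \<Rightarrow> (real ^ 'n) \<times> real" where
  "graph_partial R u j x = (R *\<^sub>R axis j 1, deriv u (R * norm x) * (R * (x $ j / norm x)))"

section \<open>Derivatives of the graph immersion away from the centre\<close>

locale C2_graph =
  fixes R :: real and u :: "real \<Rightarrow> real"
  assumes R_pos: "R > 0" and C2: "C2_on {0<..<R} u"
begin

lemma has_deriv_u:
  assumes "0 < y" "y < R"
  shows "(u has_real_derivative deriv u y) (at y)"
    and "(deriv u has_real_derivative deriv (deriv u) y) (at y)"
  using C2 assms unfolding C2_on_def
  by (auto simp: differentiable_on_def at_within_open[of _ "{0<..<R}"] DERIV_deriv_iff_real_differentiable)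

lemma has_derivative_graph_immersion:
  assumes "0 < norm x" "norm x < 1"
  shows "(graph_immersion R u has_derivative
           (\<lambda>v. (R *\<^sub>R v, deriv u (R * norm x) * (R * (v \<bullet> sgn x))))) (at x)"
proof -
  have "((\<lambda>x. u (R * norm x)) has_derivative
          (\<lambda>v. deriv u (R * norm x) * (R * (v \<bullet> sgn x)))) (at x)"
    by (rule has_derivative_radial) (use assms R_pos in \<open>auto intro!: has_deriv_u\<close>)
  then show ?thesis
    unfolding graph_immersion_def[abs_def]
    by (auto intro!: derivative_eq_intros)
qed

lemma has_derivative_graph_partial:
  assumes "0 < norm x" "norm x < 1"
  shows "(graph_partial R u j has_derivative
           (\<lambda>v. (0, deriv u (R * norm x) * (R * (v $ j / norm x - x $ j * (v \<bullet> sgn x) / (norm x)\<^sup>2)) +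
                    deriv (deriv u) (R * norm x) * (R * (v \<bullet> sgn x)) * (R * (x $ j / norm x))))) (at x)"
proof -
  have "((\<lambda>x. deriv u (R * norm x)) has_derivative
          (\<lambda>v. deriv (deriv u) (R * norm x) * (R * (v \<bullet> sgn x)))) (at x)"
    by (rule has_derivative_radial) (use assms R_pos in \<open>auto intro!: has_deriv_u\<close>)
  moreover have "((\<lambda>x. R * (x $ j / norm x)) has_derivative
      (\<lambda>v. R * (v $ j / norm x - x $ j * (v \<bullet> sgn x) / (norm x)\<^sup>2))) (at x)"
  proof -
    have "x \<noteq> 0"
      using assms by auto
    have "((\<lambda>x. x $ j) has_derivative (\<lambda>v. v $ j)) (at x)"
      by (intro bounded_linear_imp_has_derivative bounded_linear_vec_nth)
    from has_derivative_divide[OF this has_derivative_norm] \<open>x \<noteq> 0\<close>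
    have "((\<lambda>x. x $ j / norm x) has_derivative
        (\<lambda>v. v $ j / norm x - x $ j * (v \<bullet> sgn x) / (norm x)\<^sup>2)) (at x)"
      by (simp add: divide_inverse power2_eq_square ac_simps)
    then show ?thesis
      by (rule has_derivative_mult_right)
  qed
  ultimately show ?thesis
    unfolding graph_partial_def[abs_def]
    by (intro has_derivative_Pair has_derivative_const has_derivative_mult)
qed

lemma partial_within_graph_immersion:
  assumes "0 < norm x" "norm x < 1"
  shows "partial_within (cball 0 1) j (graph_immersion R u) x = graph_partial R u j x"
proof -
  have "axis j 1 \<bullet> sgn x = x $ j / norm x"
    by (simp add: inner_axis' sgn_div_norm divide_inverse)
  then show ?thesis
    using partial_within_eq[OF has_derivative_graph_immersion[OF assms], of "cball 0 1" j] assms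
    by (simp add: graph_partial_def)
qed

lemma eventually_punctured_ball:
  fixes x :: "real ^ 'n"
  assumes "0 < norm x" "norm x < 1"
  shows "\<forall>\<^sub>F x' in nhds x. 0 < norm x' \<and> norm x' < 1"
proof -
  have "open (ball (0::real ^ 'n) 1 - {0})"
    by auto
  then have "\<forall>\<^sub>F x' in nhds x. x' \<in> ball 0 1 - {0}"
    using assms by (intro eventually_nhds_in_open) auto
  then show ?thesis
    by eventually_elim auto
qed

text \<open>On the punctured open disk, a neighbourhood of \<open>x\<close>, the closed form
  \<open>graph_partial\<close> equals the partial derivative, so its derivative carries
  over.\<close>

lemma has_derivative_partial_within:
  assumes "0 < norm x" "norm x < 1"
  shows "(partial_within (cball 0 1) j (graph_immersion R u) has_derivative
           (\<lambda>v. (0, deriv u (R * norm x) * (R * (v $ j / norm x - x $ j * (v \<bullet> sgn x) / (norm x)\<^sup>2)) +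
                    deriv (deriv u) (R * norm x) * (R * (v \<bullet> sgn x)) * (R * (x $ j / norm x))))) (at x)"
proof (rule has_derivative_transform_eventually[OF has_derivative_graph_partial[OF assms]])
  have "\<forall>\<^sub>F x' in nhds x. graph_partial R u j x' = partial_within (cball 0 1) j (graph_immersion R u) x'"
    using eventually_punctured_ball[OF assms]
    by eventually_elim (simp add: partial_within_graph_immersion)
  then show "\<forall>\<^sub>F x' in at x. graph_partial R u j x' = partial_within (cball 0 1) j (graph_immersion R u) x'"
    by (simp add: eventually_nhds_conv_at)
qed (use assms in \<open>auto simp: partial_within_graph_immersion\<close>)

text \<open>The Type 0 bound is conditional on this predicate; here the condition is discharged on
  the punctured open disk.\<close>

lemma twice_differentiable_graph_immersion:
  assumes "0 < norm x" "norm x < 1"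
  shows "twice_differentiable_within (cball 0 1) (graph_immersion R u) x"
  unfolding twice_differentiable_within_def
proof (intro conjI allI)
  show "graph_immersion R u differentiable at x within cball 0 1"
    by (rule differentiable_at_withinI[OF differentiableI[OF has_derivative_graph_immersion[OF assms]]])
  have "\<forall>\<^sub>F x' in at x within cball 0 1. 0 < norm x' \<and> norm x' < 1"
    using eventually_punctured_ball[OF assms] unfolding eventually_at_filter
    by (rule eventually_mono) simp
  then show "\<forall>\<^sub>F x' in at x within cball 0 1. graph_immersion R u differentiable at x' within cball 0 1"
  proof eventually_elim
    case (elim x')
    then show ?case
      by (intro differentiable_at_withinI[OF differentiableI[OF has_derivative_graph_immersion]]) auto
  qed
  show "partial_within (cball 0 1) i (graph_immersion R u) differentiable at x within cball 0 1" for i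
    by (rule differentiable_at_withinI[OF differentiableI[OF has_derivative_partial_within[OF assms]]])
qed

text \<open>On a coordinate axis both fundamental forms are diagonal.\<close>

lemma rotational_curvature_le_norm_A_sq:
  fixes k l :: "'n::finite"
  assumes s: "0 < s" "s < 1" and "k \<noteq> l"
  shows "(deriv u (R * s))\<^sup>2 \<le>
    norm_A_sq (cball 0 1) (graph_immersion R u) (axis k s) * (R * s)\<^sup>2 * (1 + (deriv u (R * s))\<^sup>2)"
proof -
  let ?X = "graph_immersion R u :: real ^ 'n \<Rightarrow> _" and ?D = "cball (0 :: real ^ 'n) 1"
  define x :: "real ^ 'n" where "x = axis k s"
  define p where "p = deriv u (R * s)"
  define q where "q = deriv (deriv u) (R * s)"
  have x: "0 < norm x" "norm x < 1" "norm x = s" and xint: "x \<in> interior ?D"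
    using s by (auto simp: x_def)
  have x_nth: "x $ j = (if j = k then s else 0)" for j
    by (auto simp: x_def axis_def)
  have sgn_x: "sgn x = axis k 1"
    using s by (simp add: sgn_div_norm vec_eq_iff x(3) x_nth) (simp add: axis_def)
  have part: "partial_within ?D j ?X x = (R *\<^sub>R axis j 1, if j = k then p * R else 0)" for j
    using s x by (simp add: partial_within_graph_immersion graph_partial_def p_def x_nth)
  \<comment> \<open>Moving along axis \<open>k\<close> fixes the direction \<open>sgn x\<close> and
    leaves only the \<open>q\<close> term; moving across it fixes the norm to first order and leaves
    only the \<open>p\<close> term.\<close>
  have part2: "partial_within ?D i (partial_within ?D j ?X) x =
      (0, if i \<noteq> j then 0 else if i = k then q * R\<^sup>2 else p * R / s)" for i j
    using partial_within_eq[OF has_derivative_partial_within[OF x(1,2), of j] xint, of i] s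
    by (simp add: x sgn_x x_nth inner_axis_axis p_def q_def power2_eq_square)
       (auto simp: axis_def field_simps)
  define \<nu> where "\<nu> = unit_normal ?D ?X x"
  have "norm \<nu> = 1 \<and> (\<forall>i. \<nu> \<bullet> partial_within ?D i ?X x = 0)"
    unfolding \<nu>_def unit_normal_def
  proof (rule someI)
    \<comment> \<open>The unit normal of the profile, placed in the plane of axis \<open>k\<close>
      and the rotation axis, shows that the choice in \<open>unit_normal\<close> is not
      vacuous.\<close>
    let ?\<mu> = "(1 / sqrt (1 + p\<^sup>2)) *\<^sub>R (axis k (- p) :: real ^ 'n, 1 :: real)"
    have "1 + p\<^sup>2 > 0" by (simp add: add_pos_nonneg)
    then show "norm ?\<mu> = 1 \<and> (\<forall>i. ?\<mu> \<bullet> partial_within ?D i ?X x = 0)"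
      unfolding part by (auto simp: norm_Pair inner_axis_axis power_divide simp flip: add_divide_distrib)
  qed
  then have \<nu>: "norm \<nu> = 1" "\<And>i. \<nu> \<bullet> partial_within ?D i ?X x = 0"
    by auto
  \<comment> \<open>Orthogonality and unit length fix the normal up to sign, and the sign disappears
    because \<open>snd \<nu>\<close> is eventually squared.\<close>
  have fst_\<nu>: "fst \<nu> $ i = (if i = k then - p * snd \<nu> else 0)" for i
  proof -
    have "R * (fst \<nu> $ i) + snd \<nu> * (if i = k then p * R else 0) = 0"
      using \<nu>(2)[of i] unfolding part by (cases \<nu>) (simp add: inner_axis)
    then have "R * (fst \<nu> $ i + snd \<nu> * (if i = k then p else 0)) = 0"
      unfolding distrib_left by (cases "i = k") (simp_all add: ac_simps)
    then show ?thesis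
      using R_pos by (simp add: eq_neg_iff_add_eq_0 mult.commute split: if_splits)
  qed
  then have "fst \<nu> = axis k (- p * snd \<nu>)"
    by (simp add: vec_eq_iff axis_def)
  then have "\<nu> = (axis k (- p * snd \<nu>), snd \<nu>)"
    by (metis prod.collapse)
  then have "1 = (- p * snd \<nu>)\<^sup>2 + (snd \<nu>)\<^sup>2"
    using \<nu>(1) by (metis norm_Pair norm_axis power2_abs real_norm_def real_sqrt_eq_1_iff)
  then have snd_\<nu>: "(snd \<nu>)\<^sup>2 * (1 + p\<^sup>2) = 1"
    by (simp add: algebra_simps power_mult_distrib)
  \<comment> \<open>Entry \<open>k\<close> belongs to the meridian direction, all others to
    rotation; \<open>h i / g i\<close> are the principal curvatures.\<close>
  define g where "g i = (if i = k then R\<^sup>2 * (1 + p\<^sup>2) else R\<^sup>2)" for i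
  define h where "h i = (if i = k then q * R\<^sup>2 else p * R / s) * snd \<nu>" for i
  have g_pos: "g i > 0" for i
    using R_pos by (simp add: g_def add_pos_nonneg)
  have I: "first_fundamental_form ?D ?X x = (\<chi> i j. if i = j then g i else 0)"
    unfolding first_fundamental_form_def part
    by (auto simp: vec_eq_iff inner_axis_axis g_def power2_eq_square algebra_simps)
  have II: "second_fundamental_form ?D ?X x = (\<chi> i j. if i = j then h i else 0)"
    unfolding second_fundamental_form_def part2 \<nu>_def[symmetric]
    by (cases \<nu>) (auto simp: vec_eq_iff h_def)
  have "matrix_inv (\<chi> i j. if i = j then g i else 0) = (\<chi> i j. if i = j then 1 / g i else 0)"
    using g_pos[THEN less_imp_neq]
    by (intro matrix_inv_eqI) (simp_all add: diagonal_matrix_mult mat_def vec_eq_iff)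
  then have "norm_A_sq ?D ?X x = (\<Sum>i\<in>UNIV. (h i / g i)\<^sup>2)"
    unfolding norm_A_sq_def I II
    by (simp add: Let_def diagonal_matrix_mult trace_def power2_eq_square)
  \<comment> \<open>One rotational direction \<open>l\<close> is kept; its principal curvature is
    \<open>p * snd \<nu> / (R * s)\<close>.\<close>
  also have "\<dots> \<ge> (h l / g l)\<^sup>2"
    by (rule member_le_sum) auto
  finally have "(h l / g l)\<^sup>2 * ((R * s)\<^sup>2 * (1 + p\<^sup>2)) \<le> norm_A_sq ?D ?X x * ((R * s)\<^sup>2 * (1 + p\<^sup>2))"
    by (intro mult_right_mono) auto
  moreover have "(h l / g l)\<^sup>2 * ((R * s)\<^sup>2 * (1 + p\<^sup>2)) = p\<^sup>2"
  proof -
    have "h l / g l * (R * s) = p * snd \<nu>"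
      using \<open>k \<noteq> l\<close> R_pos s by (simp add: h_def g_def power2_eq_square)
    then have "(h l / g l)\<^sup>2 * (R * s)\<^sup>2 = p\<^sup>2 * (snd \<nu>)\<^sup>2"
      by (metis power_mult_distrib)
    then show ?thesis
      using snd_\<nu> by (simp flip: mult.assoc)
  qed
  ultimately show ?thesis
    by (simp add: p_def x_def mult.assoc)
qed

end

section \<open>Boundary slope and contraction\<close>

text \<open>By the mean value theorem the difference quotients at \<open>b\<close> are slopes at
  interior points, so the bound on interior slopes survives in the limit.\<close>

lemma left_derivative_abs_le:
  fixes f :: "real \<Rightarrow> real"
  assumes "a < b" and f': "(f has_real_derivative p) (at_left b)"
    and diff: "\<And>y. a < y \<Longrightarrow> y < b \<Longrightarrow> (f has_real_derivative f' y) (at y)"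
    and bound: "\<And>y. a < y \<Longrightarrow> y < b \<Longrightarrow> \<bar>f' y\<bar> \<le> K"
  shows "\<bar>p\<bar> \<le> K"
proof -
  have cont: "continuous (at_left b) f"
    using f' DERIV_continuous by blast
  have "((\<lambda>y. \<bar>(f y - f b) / (y - b)\<bar>) \<longlongrightarrow> \<bar>p\<bar>) (at_left b)"
    using f' by (intro tendsto_rabs) (simp add: has_field_derivative_iff)
  moreover have "\<forall>\<^sub>F y in at_left b. \<bar>(f y - f b) / (y - b)\<bar> \<le> K"
    using eventually_at_left_real[OF \<open>a < b\<close>]
  proof eventually_elim
    case (elim y)
    \<comment> \<open>At the endpoint \<open>b\<close> continuity comes from the left derivative
      alone.\<close>
    have "continuous_on {y..b} f"
      unfolding continuous_on_eq_continuous_within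
    proof
      fix z assume "z \<in> {y..b}"
      show "continuous (at z within {y..b}) f"
      proof (cases "z = b")
        case True
        have "continuous (at b within {..<b}) f" using cont .
        then have "continuous (at b within insert b {..<b}) f"
          by (simp add: continuous_within at_within_def)
        then show ?thesis
          using True by (rule_tac continuous_within_subset[of _ "insert b {..<b}"]) auto
      next
        case False
        then have "a < z" "z < b"
          using \<open>z \<in> {y..b}\<close> elim by auto
        then show ?thesis
          by (rule continuous_at_imp_continuous_at_within[OF DERIV_isCont[OF diff]])
      qed
    qed
    moreover have "f differentiable at z" if "y < z" "z < b" for z
      using that elim unfolding real_differentiable_def by (intro exI[of _ "f' z"] diff) auto
    ultimately obtain l z where "y < z" "z < b" "DERIV f z :> l" "f b - f y = (b - y) * l"
      using MVT[of y b f] elim by auto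
    moreover have "l = f' z"
      using DERIV_unique[OF \<open>DERIV f z :> l\<close> diff] elim \<open>y < z\<close> \<open>z < b\<close> by auto
    moreover have "(f y - f b) / (y - b) = (f b - f y) / (b - y)"
      by (metis minus_diff_eq minus_divide_divide)
    ultimately show ?case
      using bound[of z] elim by auto
  qed
  ultimately show ?thesis
    by (rule tendsto_upperbound) (simp add: trivial_limit_at_left_real)
qed

text \<open>Multiplied by the integrating factor \<open>exp (- K * z)\<close>, \<open>f\<close>
  becomes nonincreasing and starts at 0. Derivatives are taken in the open interval because the
  profile may have none at 0.\<close>

lemma Gronwall_zero:
  fixes f :: "real \<Rightarrow> real"
  assumes "0 < b" "continuous_on {0..b} f" "f 0 = 0"
    and f': "\<And>z. 0 < z \<Longrightarrow> z < b \<Longrightarrow> (f has_real_derivative f' z) (at z)"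
    and bound: "\<And>z. 0 < z \<Longrightarrow> z < b \<Longrightarrow> f' z \<le> K * f z"
  shows "f b \<le> 0"
proof -
  have "f b * exp (- K * b) \<le> f 0 * exp (- K * 0)"
  proof (rule DERIV_nonpos_imp_decreasing_open[of 0 b "\<lambda>z. f z * exp (- K * z)"])
    fix z assume z: "0 < z" "z < b"
    have "((\<lambda>z. f z * exp (- K * z)) has_real_derivative (f' z - K * f z) * exp (- K * z)) (at z)"
      using f'[OF z] by (auto intro!: derivative_eq_intros simp: algebra_simps)
    moreover have "(f' z - K * f z) * exp (- K * z) \<le> 0"
      using bound[OF z] by (simp add: mult_nonpos_nonneg)
    ultimately show "\<exists>y. ((\<lambda>z. f z * exp (- K * z)) has_real_derivative y) (at z) \<and> y \<le> 0"
      by blast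
  qed (use assms in \<open>auto intro!: continuous_intros\<close>)
  then show ?thesis
    using \<open>f 0 = 0\<close> by (simp add: mult_le_0_iff)
qed

text \<open>Intermediate value theorem between time \<open>a\<close>, where \<open>h\<close> exceeds
  \<open>z\<close>, and a time near \<open>T\<close>, where the limit forces \<open>h\<close> below
  \<open>z\<close>.\<close>

lemma boundary_height_sweeps:
  fixes h :: "real \<Rightarrow> real"
  assumes cont: "continuous_on {a..<T} h" and "a < T" and lim: "(h \<longlongrightarrow> 0) (at_left T)"
    and "0 < z" "z < h a"
  shows "\<exists>t\<in>{a<..<T}. h t = z"
proof -
  have "\<forall>\<^sub>F t in at_left T. h t < z"
    using lim \<open>0 < z\<close> by (rule order_tendstoD)
  then have "\<forall>\<^sub>F t in at_left T. h t < z \<and> t \<in> {a<..<T}"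
    using eventually_at_left_real[OF \<open>a < T\<close>] by (rule eventually_conj)
  then obtain b where b: "h b < z" "a < b" "b < T"
    using eventually_happens[of _ "at_left T"] by (auto simp: trivial_limit_at_left_real)
  have "continuous_on {a..b} h"
    using cont by (rule continuous_on_subset) (use b in auto)
  then obtain t where "a \<le> t" "t \<le> b" "h t = z"
    using IVT2'[of h b z a] b \<open>z < h a\<close> by auto
  then show ?thesis
    using b \<open>z < h a\<close> by (intro bexI[of _ t]) (auto simp: less_le)
qed

text \<open>The sign \<open>\<sigma>\<close> selects the side of the pinching point on which the boundary lies.\<close>

lemma no_linear_slope_bound:
  fixes f h :: "real \<Rightarrow> real"
  assumes cont_f: "continuous_on UNIV f" and f_pos: "\<And>z. z \<noteq> 0 \<Longrightarrow> f z > 0" and "f 0 = 0"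
    and diff: "\<And>z. z \<noteq> 0 \<Longrightarrow> (f has_real_derivative deriv f z) (at z)"
    and "a < T" and cont: "continuous_on {a..<T} h" and lim: "(h \<longlongrightarrow> 0) (at_left T)"
    and "h a \<noteq> 0"
    and bound: "\<And>t. a < t \<Longrightarrow> t < T \<Longrightarrow> \<bar>deriv f (h t)\<bar> \<le> K * f (h t)"
  shows False
proof -
  define \<sigma> where "\<sigma> = sgn (h a)"
  have \<sigma>: "\<sigma> * \<sigma> = 1" "\<bar>\<sigma>\<bar> = 1" "\<sigma> * h a = \<bar>h a\<bar>" "\<sigma> \<noteq> 0"
    using \<open>h a \<noteq> 0\<close> by (auto simp: \<sigma>_def sgn_if)
  \<comment> \<open>The argument is \<open>h a\<close> itself, where \<open>f\<close> is positive;
    Gronwall runs from the pinching point to it.\<close>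
  have "f (\<sigma> * \<bar>h a\<bar>) \<le> 0"
  proof (rule Gronwall_zero[where f = "\<lambda>z. f (\<sigma> * z)"])
    fix z assume z: "0 < z" "z < \<bar>h a\<bar>"
    then have "((\<lambda>z. f (\<sigma> * z)) has_real_derivative deriv f (\<sigma> * z) * \<sigma>) (at z)"
      using \<sigma>(4) by (intro DERIV_chain'[where g = f]) (auto intro!: derivative_eq_intros diff)
    then show "((\<lambda>z. f (\<sigma> * z)) has_real_derivative deriv f (\<sigma> * z) * \<sigma>) (at z)" .
    \<comment> \<open>Every height in between is attained at some time, so a bound along the
      boundary path becomes a differential inequality in \<open>z\<close>.\<close>
    have "\<exists>t\<in>{a<..<T}. \<sigma> * h t = z"
      using z \<sigma>(3) tendsto_mult_right_zero[OF lim, of \<sigma>]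
      by (intro boundary_height_sweeps) (auto intro!: continuous_intros cont \<open>a < T\<close>)
    then obtain t where t: "a < t" "t < T" "\<sigma> * h t = z"
      by auto
    then have "h t = \<sigma> * z"
      using \<sigma>(1) by (metis mult.assoc mult_1)
    then have "\<bar>deriv f (\<sigma> * z) * \<sigma>\<bar> \<le> K * f (\<sigma> * z)"
      using bound[OF t(1,2)] \<sigma>(2) by (simp add: abs_mult)
    then show "deriv f (\<sigma> * z) * \<sigma> \<le> K * f (\<sigma> * z)"
      by simp
  qed (use \<open>h a \<noteq> 0\<close> \<open>f 0 = 0\<close> in
      \<open>auto intro!: continuous_on_compose2[OF cont_f] continuous_intros\<close>)
  then show False
    using f_pos[of "\<sigma> * \<bar>h a\<bar>"] \<sigma>(4) \<open>h a \<noteq> 0\<close> by simp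
qed

text \<open>The bound on the rotational curvature gives p^2 <= C y^2 (1 + p^2) for the slope p at
  radius y; for small \<open>R\<close> the p^2 on the right is absorbed. The interior slope bound
  passes to y = \<open>R\<close>, where the free boundary condition expresses slope and radius
  through \<open>\<omega>S\<close>.\<close>

lemma boundary_slope_bound:
  fixes C :: real
  assumes card: "CARD('n) \<ge> 2" and R: "R > 0" and C2: "C2_on {0<..<R} u"
    and fb: "free_boundary_condition \<omega>S R u"
    and A: "\<And>x :: real ^ 'n. x \<in> cball 0 1 \<Longrightarrow>
      twice_differentiable_within (cball 0 1) (graph_immersion R u) x \<Longrightarrow>
      norm_A_sq (cball 0 1) (graph_immersion R u) x \<le> C"
    and "C \<ge> 0" and small: "C * R\<^sup>2 \<le> 1 / 2"
  shows "\<bar>deriv \<omega>S (u R)\<bar> \<le> sqrt (2 * C) * \<omega>S (u R)"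
proof -
  interpret C2_graph R u
    using R C2 by unfold_locales
  \<comment> \<open>In dimension at least 2 there is a rotational direction \<open>l\<close> besides
    the meridian direction \<open>k\<close>.\<close>
  obtain k l :: 'n where "k \<noteq> l"
    using card card_le_Suc0_iff_eq[of "UNIV :: 'n set"] by auto
  have slope: "\<bar>deriv u y\<bar> \<le> sqrt (2 * C) * R" if y: "0 < y" "y < R" for y
  proof -
    let ?p = "deriv u y" and ?N = "norm_A_sq (cball 0 1) (graph_immersion R u) (axis k (y / R))"
    have s: "0 < y / R" "y / R < 1"
      using y R by auto
    have "?p\<^sup>2 \<le> ?N * y\<^sup>2 * (1 + ?p\<^sup>2)"
      using rotational_curvature_le_norm_A_sq[OF s \<open>k \<noteq> l\<close>] R by simp
    also have "?N \<le> C"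
      using s y R by (intro A twice_differentiable_graph_immersion) simp_all
    then have "?N * y\<^sup>2 * (1 + ?p\<^sup>2) \<le> C * R\<^sup>2 * (1 + ?p\<^sup>2)"
      using y \<open>C \<ge> 0\<close> by (intro mult_right_mono mult_mono power_mono) auto
    \<comment> \<open>The threshold 1/2 leaves half of the squared slope on the left, whence the
      factor 2 in \<open>sqrt (2 * C)\<close>.\<close>
    also have "\<dots> \<le> C * R\<^sup>2 + 1 / 2 * ?p\<^sup>2"
      using mult_right_mono[OF small, of "?p\<^sup>2"] by (simp add: distrib_left)
    finally have "?p\<^sup>2 \<le> (sqrt (2 * C) * R)\<^sup>2"
      using \<open>C \<ge> 0\<close> by (simp add: power_mult_distrib)
    then show ?thesis
      using R \<open>C \<ge> 0\<close> abs_le_square_iff[of ?p "sqrt (2 * C) * R"] by simp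
  qed
  obtain p where p: "(u has_real_derivative p) (at_left R)" "p = - deriv \<omega>S (u R)" "R = \<omega>S (u R)"
    using fb by (auto simp: free_boundary_condition_def orthogonality_iff_slope)
  have "\<bar>p\<bar> \<le> sqrt (2 * C) * R"
    by (rule left_derivative_abs_le[OF R p(1) has_deriv_u(1) slope])
  then show ?thesis
    using p(2,3) by simp
qed

section \<open>Application to the flow near time \<open>T\<close>\<close>

theorem theorem1p4:
  fixes \<omega>S :: "real \<Rightarrow> real" and C\<^sub>\<Sigma> :: real
    and r0 :: real and \<omega>0 :: "real \<Rightarrow> real"
    and T :: real and r :: "real \<Rightarrow> real" and \<omega> :: "real \<Rightarrow> real \<Rightarrow> real"
    and F :: "real ^ 'n \<Rightarrow> real \<Rightarrow> (real ^ 'n) \<times> real"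
  assumes "CARD('n) \<ge> 2"
    and "pinching_cylinder \<omega>S"
    and "C\<^sub>\<Sigma> \<ge> 0" and "graph_condition \<omega>S C\<^sub>\<Sigma>"
    and "\<And>z. z \<noteq> 0 \<Longrightarrow> z * deriv \<omega>S z > 0"
    and "admissible_initial_data \<omega>S r0 \<omega>0"
    and "maximal_fb_flow CARD('n) \<omega>S r0 \<omega>0 T r \<omega>"
    and "F = rotational_family r \<omega>"
    and "contracts_to T F (0, 0)"
  shows "\<not> type_0_singularity T F"
proof
  assume "type_0_singularity T F"
  then obtain \<epsilon> C0 where "\<epsilon> > 0" and A0: "\<And>t x. t \<in> {T - \<epsilon><..<T} \<Longrightarrow> x \<in> cball 0 1 \<Longrightarrow>
      twice_differentiable_within (cball 0 1) (\<lambda>x. F x t) x \<Longrightarrow>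
      norm_A_sq (cball 0 1) (\<lambda>x. F x t) x \<le> C0"
    unfolding type_0_singularity_def by blast
  \<comment> \<open>The given bound \<open>C0\<close> may be negative; the square root and the
    monotonicity steps want a nonnegative constant.\<close>
  define C where "C = max C0 0"
  define h where "h t = \<omega> (r t) t" for t
  have flow: "fb_flow CARD('n) \<omega>S r0 \<omega>0 T r \<omega>"
    using assms(7) by (simp add: maximal_fb_flow_def)
  then have "T > 0" and r_pos: "\<And>t. 0 \<le> t \<Longrightarrow> t < T \<Longrightarrow> r t > 0" and r_cont: "continuous_on {0..<T} r"
    and \<omega>_cont: "continuous_on {(y, t). t \<in> {0..<T} \<and> y \<in> {0..r t}} (\<lambda>(y, t). \<omega> y t)"
    and C2: "\<And>t. 0 \<le> t \<Longrightarrow> t < T \<Longrightarrow> C2_on {0<..<r t} (\<lambda>y. \<omega> y t)"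
    and fb: "\<And>t. 0 \<le> t \<Longrightarrow> t < T \<Longrightarrow> free_boundary_condition \<omega>S (r t) (\<lambda>y. \<omega> y t)"
    unfolding fb_flow_def by auto
  have F_eq: "(\<lambda>x. F x t) = graph_immersion (r t) (\<lambda>y. \<omega> y t)" if "0 \<le> t" "t < T" for t
    using r_pos[OF that] by (simp add: assms(8) rotational_family_def graph_immersion_def fun_eq_iff)
  have \<omega>S: "continuous_on UNIV \<omega>S" "\<And>z. z \<noteq> 0 \<Longrightarrow> \<omega>S z > 0" "\<omega>S 0 = 0"
    using assms(2) by (auto simp: pinching_cylinder_def less_le)
  have \<omega>S_deriv: "(\<omega>S has_real_derivative deriv \<omega>S z) (at z)" if "z \<noteq> 0" for z
  proof -
    have "(deriv ^^ 0) \<omega>S differentiable_on (- {0})"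
      using assms(2) unfolding pinching_cylinder_def by blast
    moreover have "open (- {0 :: real})"
      by auto
    ultimately have "\<omega>S differentiable (at z)"
      using that by (simp add: differentiable_on_eq_differentiable_at)
    then show ?thesis
      by (simp add: DERIV_deriv_iff_real_differentiable)
  qed
  \<comment> \<open>A boundary point of the disk is mapped to radius \<open>r t\<close> and height
    \<open>h t\<close>, so contraction to the origin makes both small.\<close>
  have radius_height: "\<forall>\<^sub>F t in at_left T. \<bar>r t\<bar> < e \<and> \<bar>h t\<bar> < e" if "e > 0" for e
  proof -
    have "\<forall>\<^sub>F t in at_left T. (\<lambda>x. F x t) ` cball 0 1 \<subseteq> ball (0, 0) e"
      using assms(9) that by (simp add: contracts_to_def)
    moreover have "\<forall>\<^sub>F t in at_left T. t \<in> {0<..<T}"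
      using eventually_at_left_real[OF \<open>T > 0\<close>] .
    ultimately show ?thesis
    proof eventually_elim
      case (elim t)
      fix k :: 'n
      have "F (axis k 1) t \<in> ball (0, 0) e"
        using elim(1) by (auto simp: image_subset_iff)
      moreover have "F (axis k 1) t = (r t *\<^sub>R axis k 1, h t)"
        using elim(2) r_pos[of t] by (simp add: assms(8) rotational_family_def h_def)
      ultimately have "norm (r t *\<^sub>R axis k 1 :: real ^ 'n, h t) < e"
        by (metis mem_ball_0 zero_prod_def)
      then show ?case
        using norm_fst_le[of "r t *\<^sub>R axis k 1 :: real ^ 'n" "h t"]
          norm_snd_le[of "h t" "r t *\<^sub>R axis k 1 :: real ^ 'n"]
        by simp
    qed
  qed
  have h_lim: "(h \<longlongrightarrow> 0) (at_left T)"
    by (rule tendstoI, rule eventually_mono[OF radius_height]) auto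
  have r_lim: "(r \<longlongrightarrow> 0) (at_left T)"
    by (rule tendstoI, rule eventually_mono[OF radius_height]) auto
  have "((\<lambda>t. C * (r t)\<^sup>2) \<longlongrightarrow> C * 0\<^sup>2) (at_left T)"
    by (intro tendsto_intros r_lim)
  then have "\<forall>\<^sub>F t in at_left T. C * (r t)\<^sup>2 < 1 / 2"
    by (rule order_tendstoD) simp
  then obtain b where b: "b < T" "\<And>t. b < t \<Longrightarrow> t < T \<Longrightarrow> C * (r t)\<^sup>2 < 1 / 2"
    by (auto simp: eventually_at_left[OF \<open>T > 0\<close>])
  \<comment> \<open>After time \<open>a\<close> the flow is defined, the curvature bound holds and
    the radius is small enough for absorption.\<close>
  define a where "a = max b (max 0 (T - \<epsilon>))"
  have a: "0 \<le> a" "b \<le> a" "T - \<epsilon> \<le> a" "a < T"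
    using b(1) \<open>T > 0\<close> \<open>\<epsilon> > 0\<close> by (auto simp: a_def)
  have "continuous_on {0..<T} (\<lambda>t. (r t, t))"
    by (intro continuous_on_Pair r_cont continuous_on_id)
  \<comment> \<open>Joint continuity of the profile up to the moving boundary makes the boundary
    height continuous in time.\<close>
  then have "continuous_on {0..<T} (\<lambda>t. (\<lambda>(y, t). \<omega> y t) (r t, t))"
    by (rule continuous_on_compose2[OF \<omega>_cont]) (use r_pos in \<open>auto simp: less_imp_le\<close>)
  then have "continuous_on {0..<T} h"
    by (simp add: h_def[abs_def])
  then have h_cont: "continuous_on {a..<T} h"
    by (rule continuous_on_subset) (use a in auto)
  \<comment> \<open>The boundary lies on the support and has positive radius, so its height avoids
    the pinching point.\<close>
  have "\<omega>S (h a) = r a"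
    using fb[of a] a by (simp add: free_boundary_condition_def h_def)
  then have "h a \<noteq> 0"
    using r_pos[of a] a \<omega>S(3) by auto
  moreover have "\<bar>deriv \<omega>S (h t)\<bar> \<le> sqrt (2 * C) * \<omega>S (h t)" if t: "a < t" "t < T" for t
    unfolding h_def
  proof (rule boundary_slope_bound[OF assms(1), where u = "\<lambda>y. \<omega> y t"])
    show "norm_A_sq (cball 0 1) (graph_immersion (r t) (\<lambda>y. \<omega> y t)) x \<le> C"
      if "x \<in> cball 0 1"
        "twice_differentiable_within (cball 0 1) (graph_immersion (r t) (\<lambda>y. \<omega> y t)) x"
      for x :: "real ^ 'n"
      using A0[of t x] that t a F_eq[of t] by (simp add: C_def)
    show "C * (r t)\<^sup>2 \<le> 1 / 2"
      using b(2)[of t] t a by simp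
  qed (use t a r_pos C2 fb in \<open>auto simp: C_def\<close>)
  ultimately show False
    using no_linear_slope_bound[OF \<omega>S \<omega>S_deriv a(4) h_cont h_lim] by blast
qed

end
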